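(* Let $p\in(1,\infty)$, $p^*=p/(p-1)$, and $\eta>0$. Let $A\subset\mathbb{R}^q$ be a compact convex set with $\operatorname{int}A\ne\emptyset$ and let $P_k\supseteq A$ be the polyhedral outer approximation of $A$ generated at iteration $k$ by the norm-minimization algorithm with $\|\cdot\|_p$ scalarization (described in the context). Let $v_i,v_j\notin A$ be vertices of $P_k$, and for $m\in\{i,j\}$ let $y_m=\arg\min_{u\in A}\|u-v_m\|_p\in\operatorname{bd}A$, $z_m=y_m-v_m$, $w_m=\nabla\|z_m\|_p$ (so $\|w_m\|_{p^*}=1$), and $\alpha_m=y_m-\eta w_m$. Define the hyperplane distances $d_{ij}:=\langle w_j,y_i-y_j\rangle\ge0$ and $d_{ji}:=\langle w_i,y_j-y_i\rangle\ge0$. Let $N_{2,p}:=q^{1/2-1/p}$ if $p\ge2$ and $N_{2,p}:=1$ if $1<p\le2$; let $c_{p,q}:=\min_{\|w\|_{p^*}=1}\|w\|_2>0$, $C_3(p,q):=\sqrt2/N_{2,p}$ and $C_2(p,q):=\sqrt2\,c_{p,q}/N_{2,p}$. Then: (i) For any $h>0$ with $d_{ij}\ge h$, $\ \|\alpha_i-\alpha_j\|_p\ge C_3(p,q)\sqrt{\eta h}$. (ii) If $\langle w_i,w_j\rangle\le0$, then $\|\alpha_i-\alpha_j\|_p\ge C_2(p,q)\,\eta$. In particular, $$\|\alpha_i-\alpha_j\|_p\ge\min\bigl\{C_2(p,q)\,\eta,\ C_3(p,q)\sqrt{\eta h}\bigr\}.$$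
   Context: $\|\cdot\|_p$ is the $\ell_p$ norm on $\mathbb{R}^q$, $\langle\cdot,\cdot\rangle$ is the Euclidean inner product, $\operatorname{bd}A$ is the boundary of $A$, and $\nabla\|z\|_p$ denotes the gradient of $\|\cdot\|_p$ at $z\neq0$, i.e. the vector with components $|z_l|^{p-1}\operatorname{sgn}(z_l)/\|z\|_p^{p-1}$, $l=1,\dots,q$. Norm-minimization algorithm with $\|\cdot\|_p$ scalarization: $P_0\supseteq A$ is a polytope that is the intersection of finitely many supporting halfspaces of $A$. Given a polytope $P_k\supseteq A$ with vertex set $\operatorname{ext}(P_k)$, for each $v\in\operatorname{ext}(P_k)$ let $y^v:=\arg\min_{y\in A}\|y-v\|_p$ (unique) and $z^v:=y^v-v$. Choose $v^k\in\operatorname{ext}(P_k)$ maximizing $\|z^v\|_p$; if $z^{v^k}\ne0$, let $w^k:=\nabla\|z^{v^k}\|_p$ and set $P_{k+1}:=P_k\cap\{y\in\mathbb{R}^q:\langle w^k,y\rangle\ge\langle w^k,y^{v^k}\rangle\}$, the last set being a halfspace that contains $A$ and supports it at $y^{v^k}$.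
   Formalization: The final "In particular" bound is stated for h>0 under the condition that d_ij ≥ h or ⟨w_i,w_j⟩ ≤ 0 (the hypotheses of (i) or (ii)); without such a condition it is false, e.g. when v_i = v_j. *)

theory Defs
  imports "HOL-Analysis.Analysis"
begin

definition lp_norm :: "real \<Rightarrow> real ^ 'q \<Rightarrow> real" where
  "lp_norm p x = (\<Sum>l\<in>UNIV. \<bar>x $ l\<bar> powr p) powr (1 / p)"

text \<open>The gradient of the norm at a point \<open>z \<noteq> 0\<close>; see \<open>lp_norm_gderiv\<close> below.\<close>

definition lp_grad :: "real \<Rightarrow> real ^ 'q \<Rightarrow> real ^ 'q" where
  "lp_grad p z = (\<chi> l. \<bar>z $ l\<bar> powr (p - 1) * sgn (z $ l) / lp_norm p z powr (p - 1))"

text \<open>The minimizer exists and is unique for \<open>p > 1\<close> and nonempty compact convex \<open>A\<close>;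
  see \<open>lp_proj_unique\<close> below.\<close>

definition lp_proj :: "real \<Rightarrow> (real ^ 'q) set \<Rightarrow> real ^ 'q \<Rightarrow> real ^ 'q" where
  "lp_proj p A v = (ARG_MIN (\<lambda>y. lp_norm p (y - v)) y. y \<in> A)"

definition supporting_halfspace :: "(real ^ 'q) set \<Rightarrow> (real ^ 'q) set \<Rightarrow> bool" where
  "supporting_halfspace A H \<longleftrightarrow>
     (\<exists>w b. w \<noteq> 0 \<and> H = {y. w \<bullet> y \<ge> b} \<and> A \<subseteq> H \<and> (\<exists>y\<in>A. w \<bullet> y = b))"

definition initial_outer_approx :: "(real ^ 'q) set \<Rightarrow> (real ^ 'q) set \<Rightarrow> bool" where
  "initial_outer_approx A P \<longleftrightarrow>
     polytope P \<and> A \<subseteq> P \<and>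
     (\<exists>F. finite F \<and> (\<forall>H\<in>F. supporting_halfspace A H) \<and> P = \<Inter> F)"

text \<open>\<open>norm_min_approx p A k P\<close>: some run of the algorithm, with some initial polytope and
  some choice of farthest vertices, has \<open>P\<close> as its outer approximation \<open>P\<^sub>k\<close>.\<close>

inductive norm_min_approx ::
    "real \<Rightarrow> (real ^ 'q) set \<Rightarrow> nat \<Rightarrow> (real ^ 'q) set \<Rightarrow> bool"
  for p :: real and A :: "(real ^ 'q) set" where
  init: "initial_outer_approx A P \<Longrightarrow> norm_min_approx p A 0 P"
| step: "norm_min_approx p A k P \<Longrightarrow>
    is_arg_max (\<lambda>u. lp_norm p (lp_proj p A u - u)) (\<lambda>u. u extreme_point_of P) v \<Longrightarrow>
    y = lp_proj p A v \<Longrightarrow> y - v \<noteq> 0 \<Longrightarrow> w = lp_grad p (y - v) \<Longrightarrow>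
    norm_min_approx p A (Suc k) (P \<inter> {x. w \<bullet> x \<ge> w \<bullet> y})"

text \<open>The constants depend on the dimension \<open>q = CARD('q)\<close>, which is passed as \<open>TYPE('q)\<close>.\<close>

definition N2_const :: "real \<Rightarrow> 'q::finite itself \<Rightarrow> real" where
  "N2_const p _ = (if p \<ge> 2 then real CARD('q) powr (1 / 2 - 1 / p) else 1)"

text \<open>The infimum is a positive minimum; see \<open>c_const_attained\<close> below.\<close>

definition c_const :: "real \<Rightarrow> 'q::finite itself \<Rightarrow> real" where
  "c_const p _ = Inf {norm w | w :: real ^ 'q. lp_norm (p / (p - 1)) w = 1}"

definition C3_const :: "real \<Rightarrow> 'q::finite itself \<Rightarrow> real" where
  "C3_const p q = sqrt 2 / N2_const p q"

definition C2_const :: "real \<Rightarrow> 'q::finite itself \<Rightarrow> real" where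
  "C2_const p q = sqrt 2 * c_const p q / N2_const p q"

lemma lp_norm_nonneg: "lp_norm p x \<ge> 0"
  by (simp add: lp_norm_def)

lemma lp_norm_powr:
  assumes "p > 0" shows "lp_norm p x powr p = (\<Sum>l\<in>UNIV. \<bar>x $ l\<bar> powr p)"
  using assms by (simp add: lp_norm_def powr_powr sum_nonneg)

lemma lp_norm_zero: "p > 0 \<Longrightarrow> lp_norm p 0 = 0"
  by (simp add: lp_norm_def)

lemma lp_norm_pos:
  assumes "p > 0" "x \<noteq> 0" shows "lp_norm p x > 0"
proof -
  obtain l where "x $ l \<noteq> 0" using assms by (auto simp: vec_eq_iff)
  then have "(\<Sum>l\<in>UNIV. \<bar>x $ l\<bar> powr p) > 0"
    by (intro sum_pos2[of _ l]) auto
  then show ?thesis by (simp add: lp_norm_def)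
qed

lemma continuous_on_lp_norm:
  assumes "p > 0" shows "continuous_on S (lp_norm p)"
  unfolding lp_norm_def using assms
  by (intro continuous_on_powr' continuous_intros) (auto simp: sum_nonneg)

lemma component_le_lp_norm:
  assumes "p > 0" shows "\<bar>x $ l\<bar> \<le> lp_norm p x"
proof -
  have "\<bar>x $ l\<bar> powr p \<le> lp_norm p x powr p"
    unfolding lp_norm_powr[OF assms] by (rule member_le_sum) auto
  then show ?thesis
    using assms lp_norm_nonneg powr_less_mono2[of p "lp_norm p x" "\<bar>x $ l\<bar>"] by force
qed

lemma c_const_attained:
  assumes "p > 1"
  shows "c_const p TYPE('q::finite) > 0"
    and "\<exists>w :: real ^ 'q. lp_norm (p / (p - 1)) w = 1 \<and> norm w = c_const p TYPE('q)"
proof -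
  define r where "r = p / (p - 1)"
  have r: "r > 0" using assms by (simp add: r_def)
  define S where "S = {w :: real ^ 'q. lp_norm r w = 1}"
  have "norm w \<le> real CARD('q)" if "w \<in> S" for w
  proof -
    have "norm w \<le> (\<Sum>l\<in>UNIV. \<bar>w $ l\<bar>)" by (rule norm_le_l1_cart)
    also have "\<dots> \<le> (\<Sum>l\<in>(UNIV::'q set). 1)"
      using that component_le_lp_norm[OF r, of w] by (intro sum_mono) (auto simp: S_def)
    finally show ?thesis by simp
  qed
  then have "bounded S" by (auto simp: bounded_iff)
  moreover have "closed S"
    unfolding S_def by (intro closed_Collect_eq continuous_on_lp_norm r continuous_intros)
  ultimately have "compact S" by (simp add: compact_eq_bounded_closed)
  moreover have "axis undefined 1 \<in> S"
  proof -
    have "\<bar>(axis undefined (1::real) :: real ^ 'q) $ l\<bar> powr r = (if l = undefined then 1 else 0)" for l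
      by (simp add: axis_def)
    then show ?thesis by (simp add: S_def lp_norm_def)
  qed
  ultimately obtain w where w: "w \<in> S" "\<And>u. u \<in> S \<Longrightarrow> norm w \<le> norm u"
    using continuous_attains_inf[of S norm] continuous_on_norm_id by blast
  have "c_const p TYPE('q) = Inf (norm ` S)"
    unfolding c_const_def S_def r_def by (rule arg_cong[of _ _ Inf]) auto
  also have "\<dots> = norm w" by (rule cInf_eq_minimum) (use w in auto)
  finally have c: "c_const p TYPE('q) = norm w" .
  then show "\<exists>w :: real ^ 'q. lp_norm (p / (p - 1)) w = 1 \<and> norm w = c_const p TYPE('q)"
    using w by (auto simp: S_def r_def)
  have "w \<noteq> 0" using w(1) lp_norm_zero[OF r, where 'a='q] by (auto simp: S_def)
  then show "c_const p TYPE('q) > 0" using c by simp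
qed

lemma abs_powr_has_derivative:
  fixes x p :: real assumes "p > 1"
  shows "((\<lambda>t. \<bar>t\<bar> powr p) has_real_derivative p * (\<bar>x\<bar> powr (p - 1) * sgn x)) (at x)"
proof (cases "x = 0")
  case True
  have "((\<lambda>t::real. \<bar>t\<bar> powr (p - 1)) \<longlongrightarrow> \<bar>0\<bar> powr (p - 1)) (at 0)"
    using assms by (intro tendsto_powr' tendsto_intros) auto
  then have "((\<lambda>t::real. \<bar>t\<bar> powr (p - 1)) \<longlongrightarrow> 0) (at 0)" by simp
  moreover have "\<forall>\<^sub>F t::real in at 0. \<bar>t\<bar> powr (p - 1) = \<bar>\<bar>t\<bar> powr p / t\<bar>"
    by (auto simp: eventually_at_filter powr_diff abs_divide)
  ultimately have "((\<lambda>t::real. \<bar>\<bar>t\<bar> powr p / t\<bar>) \<longlongrightarrow> 0) (at 0)"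
    by (rule Lim_transform_eventually)
  then have "((\<lambda>t::real. \<bar>t\<bar> powr p / t) \<longlongrightarrow> 0) (at 0)"
    by (rule tendsto_rabs_zero_cancel)
  then show ?thesis using True by (simp add: has_field_derivative_iff)
next
  case False
  have A: "(abs has_real_derivative sgn x) (at x)"
  proof (cases "x > 0")
    case True
    show ?thesis
      by (rule has_field_derivative_transform_within_open[of "\<lambda>t. t" _ _ "{0<..}"])
        (use True in auto)
  next
    case nonpos: False
    show ?thesis
      by (rule has_field_derivative_transform_within_open[of "\<lambda>t. - t" _ _ "{..<0}"])
        (use False nonpos in \<open>auto intro: DERIV_minus DERIV_ident\<close>)
  qed
  have "((\<lambda>t. \<bar>t\<bar> powr p) has_real_derivative p * \<bar>x\<bar> powr (p - 1) * sgn x) (at x)"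
    by (rule DERIV_chain2[OF has_real_derivative_powr A]) (use False in simp)
  then show ?thesis by (simp add: mult.assoc)
qed

lemma lp_norm_gderiv:
  assumes "p > 1" "z \<noteq> 0"
  shows "GDERIV (lp_norm p) z :> lp_grad p z"
proof -
  let ?s = "\<lambda>x. \<Sum>l\<in>UNIV. \<bar>x $ l\<bar> powr p"
  have N: "lp_norm p z > 0" using assms by (intro lp_norm_pos) auto
  have s: "?s z = lp_norm p z powr p" using lp_norm_powr[of p z] assms by simp
  have "((\<lambda>x. \<bar>x $ l\<bar> powr p) has_derivative
      (\<lambda>h. h $ l * (p * (\<bar>z $ l\<bar> powr (p - 1) * sgn (z $ l))))) (at z)" for l
    using DERIV_compose_FDERIV[where g = "\<lambda>x. x $ l" and g' = "\<lambda>h. h $ l" and x = z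
        and s = UNIV, OF abs_powr_has_derivative[OF assms(1), of "z $ l"]]
    by (simp add: bounded_linear_imp_has_derivative bounded_linear_vec_nth)
  then have D: "(?s has_derivative
      (\<lambda>h. \<Sum>l\<in>UNIV. h $ l * (p * (\<bar>z $ l\<bar> powr (p - 1) * sgn (z $ l))))) (at z)"
    by (intro has_derivative_sum) auto
  have e: "?s z powr (1 / p - 1) = 1 / lp_norm p z powr (p - 1)"
    using assms N by (simp add: s powr_powr algebra_simps powr_diff)
  have "(lp_norm p has_derivative
      (\<lambda>h. (\<Sum>l\<in>UNIV. h $ l * (p * (\<bar>z $ l\<bar> powr (p - 1) * sgn (z $ l))))
        * (1 / p * ?s z powr (1 / p - 1)))) (at z)"
    unfolding lp_norm_def
    by (rule DERIV_compose_FDERIV[OF has_real_derivative_powr D]) (use s N in auto)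
  moreover have "(\<Sum>l\<in>UNIV. h $ l * (p * (\<bar>z $ l\<bar> powr (p - 1) * sgn (z $ l))))
        * (1 / p * ?s z powr (1 / p - 1)) = h \<bullet> lp_grad p z" for h
    using assms unfolding e inner_vec_def lp_grad_def sum_distrib_right
    by (intro sum.cong) auto
  ultimately show ?thesis by (simp add: gderiv_def)
qed

lemma abs_powr_deriv_strict_mono:
  fixes a b p :: real assumes "p > 1" "a < b"
  shows "\<bar>a\<bar> powr (p - 1) * sgn a < \<bar>b\<bar> powr (p - 1) * sgn b"
proof -
  consider "a \<ge> 0" | "b \<le> 0" | "a < 0" "b > 0" by linarith
  then show ?thesis
  proof cases
    case 1
    then show ?thesis using assms powr_less_mono2[of "p - 1" a b] by (auto simp: sgn_if)
  next
    case 2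
    then show ?thesis using assms powr_less_mono2[of "p - 1" "- b" "- a"] by (auto simp: sgn_if)
  next
    case 3
    then have "\<bar>a\<bar> powr (p - 1) > 0" "\<bar>b\<bar> powr (p - 1) > 0" by auto
    then have "- (\<bar>a\<bar> powr (p - 1)) < \<bar>b\<bar> powr (p - 1)" by linarith
    then show ?thesis using 3 by (simp add: sgn_if)
  qed
qed

lemma abs_powr_midpoint:
  fixes a b p :: real assumes "p > 1" "a < b"
  shows "\<bar>(a + b) / 2\<bar> powr p < (\<bar>a\<bar> powr p + \<bar>b\<bar> powr p) / 2"
proof -
  let ?f = "\<lambda>t. \<bar>t\<bar> powr p" and ?g = "\<lambda>x. p * (\<bar>x\<bar> powr (p - 1) * sgn x)"
  define m where "m = (a + b) / 2"
  have m: "a < m" "m < b" "b - m = m - a" using assms by (auto simp: m_def field_simps)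
  obtain c where c: "c < m" "?f m - ?f a = (m - a) * ?g c"
    using MVT2[of a m ?f ?g] m abs_powr_has_derivative[OF assms(1)] by blast
  obtain d where d: "m < d" "?f b - ?f m = (b - m) * ?g d"
    using MVT2[of m b ?f ?g] m abs_powr_has_derivative[OF assms(1)] by blast
  have "?g c < ?g d"
    using abs_powr_deriv_strict_mono[of p c d] assms c d by simp
  then have "(m - a) * ?g c < (m - a) * ?g d"
    by (rule mult_strict_left_mono) (use m in simp)
  then have "?f m - ?f a < ?f b - ?f m" using c d m by simp
  then show ?thesis by (simp add: m_def)
qed

lemma lp_proj_unique:
  assumes "p > 1" "compact A" "convex A" "A \<noteq> {}"
  shows "\<exists>!y. is_arg_min (\<lambda>y. lp_norm p (y - v)) (\<lambda>y. y \<in> A) y"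
proof (rule ex_ex1I)
  have p: "p > 0" using assms by simp
  have "continuous_on A (\<lambda>y. lp_norm p (y - v))"
    by (rule continuous_on_compose2[OF continuous_on_lp_norm[OF p, of UNIV]])
      (auto intro!: continuous_intros)
  then show "\<exists>y. is_arg_min (\<lambda>y. lp_norm p (y - v)) (\<lambda>y. y \<in> A) y"
    using continuous_attains_inf[of A "\<lambda>y. lp_norm p (y - v)"] assms
    by (auto simp: is_arg_min_linorder)
next
  fix x y
  assume x: "is_arg_min (\<lambda>y. lp_norm p (y - v)) (\<lambda>y. y \<in> A) x"
    and y: "is_arg_min (\<lambda>y. lp_norm p (y - v)) (\<lambda>y. y \<in> A) y"
  have p: "p > 0" using assms by simp
  show "x = y"
  proof (rule ccontr)
    assume "x \<noteq> y"
    then obtain l where l: "x $ l \<noteq> y $ l" by (auto simp: vec_eq_iff)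
    define N where "N = lp_norm p (x - v)"
    have Ny: "lp_norm p (y - v) = N"
      using x y unfolding N_def is_arg_min_linorder by (auto intro: antisym)
    define m where "m = (1 / 2) *\<^sub>R x + (1 / 2) *\<^sub>R y"
    have "m \<in> A"
      using x y \<open>convex A\<close> unfolding m_def is_arg_min_linorder by (intro convexD) auto
    then have Nm: "N \<le> lp_norm p (m - v)" using x by (auto simp: N_def is_arg_min_linorder)
    let ?f = "\<lambda>u l. \<bar>(u - v) $ l\<bar> powr p"
    have str: "?f m l < (?f x l + ?f y l) / 2" if ne: "x $ l \<noteq> y $ l" for l
    proof -
      have mid: "(m - v) $ l = ((x - v) $ l + (y - v) $ l) / 2" by (simp add: m_def field_simps)
      consider "(x - v) $ l < (y - v) $ l" | "(y - v) $ l < (x - v) $ l"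
        using ne unfolding vector_minus_component by linarith
      then show ?thesis unfolding mid
      proof cases
        case 1
        then show "\<bar>((x - v) $ l + (y - v) $ l) / 2\<bar> powr p < (?f x l + ?f y l) / 2"
          by (rule abs_powr_midpoint[OF assms(1)])
      next
        case 2
        then show "\<bar>((x - v) $ l + (y - v) $ l) / 2\<bar> powr p < (?f x l + ?f y l) / 2"
          using abs_powr_midpoint[OF assms(1) 2] by (simp only: add.commute)
      qed
    qed
    have weak: "?f m l \<le> (?f x l + ?f y l) / 2" for l
    proof (cases "x $ l = y $ l")
      case True
      then have "m $ l = x $ l" by (simp add: m_def)
      then show ?thesis using True by simp
    qed (use str in \<open>auto intro: less_imp_le\<close>)
    have "lp_norm p (m - v) powr p = (\<Sum>l\<in>UNIV. ?f m l)" by (rule lp_norm_powr[OF p])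
    also have "\<dots> < (\<Sum>l\<in>UNIV. (?f x l + ?f y l) / 2)"
      using str[OF l] weak by (intro sum_strict_mono_ex1) auto
    also have "\<dots> = (lp_norm p (x - v) powr p + lp_norm p (y - v) powr p) / 2"
      by (simp add: lp_norm_powr[OF p] sum.distrib sum_divide_distrib[symmetric])
    also have "\<dots> = N powr p" by (simp add: Ny N_def[symmetric])
    finally have "lp_norm p (m - v) powr p < N powr p" .
    moreover have "N powr p \<le> lp_norm p (m - v) powr p"
      using Nm p lp_norm_nonneg[of p "x - v"] by (intro powr_mono2) (auto simp: N_def)
    ultimately show False by simp
  qed
qed

end

theory Submission
  imports Defs
begin

text \<open>
  Two facts carry the theorem. First, \<open>w\<^sub>m\<close> is the gradient at \<open>y\<^sub>m\<close> of the distance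
  \<open>\<parallel>u - v\<^sub>m\<parallel>\<^sub>p\<close>, as a function of \<open>u\<close>, and \<open>y\<^sub>m\<close> minimizes this distance over the convex
  set \<open>A\<close>, so the first-order condition \<open>w\<^sub>m \<bullet> (u - y\<^sub>m) \<ge> 0\<close> holds for every \<open>u \<in> A\<close>
  (\<open>lp_proj_variational\<close>). It makes both hyperplane distances nonnegative and forces
  \<open>y\<^sub>m\<close> onto the boundary, because an interior point could be moved against \<open>w\<^sub>m\<close>.

  Second, the estimate itself is Euclidean. With \<open>d\<^sub>i\<^sub>j = w\<^sub>j \<bullet> (y\<^sub>i - y\<^sub>j)\<close> and
  \<open>d\<^sub>j\<^sub>i = w\<^sub>i \<bullet> (y\<^sub>j - y\<^sub>i)\<close>, expanding the square gives
  \<open>\<parallel>\<alpha>\<^sub>i - \<alpha>\<^sub>j\<parallel>\<^sup>2 = \<parallel>y\<^sub>i - y\<^sub>j\<parallel>\<^sup>2 + 2\<eta>(d\<^sub>i\<^sub>j + d\<^sub>j\<^sub>i) + \<eta>\<^sup>2\<parallel>w\<^sub>i - w\<^sub>j\<parallel>\<^sup>2\<close>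
  (\<open>norm_shifted_diff_square\<close>), a sum of nonnegative terms. Keeping the middle term alone
  yields \<open>2\<eta>h\<close>; keeping the last alone yields \<open>\<eta>\<^sup>2(\<parallel>w\<^sub>i\<parallel>\<^sup>2 + \<parallel>w\<^sub>j\<parallel>\<^sup>2) \<ge> 2\<eta>\<^sup>2c\<^sup>2\<close> when the gradients
  form a non-acute angle, since they lie on the dual unit sphere (\<open>lp_norm_conjugate_grad\<close>), on
  which the Euclidean norm is at least \<open>c\<close>. Finally \<open>norm_le_N2_lp_norm\<close> passes from the
  Euclidean norm to the \<open>p\<close>-norm.
\<close>

section \<open>Comparison of the \<open>\<ell>\<^sub>p\<close> norms\<close>

lemma norm_eq_lp_norm_2: "norm x = lp_norm 2 x"
  by (simp add: norm_vec_def L2_set_def lp_norm_def powr_half_sqrt sum_nonneg)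

text \<open>After scaling to \<open>\<parallel>x\<parallel>\<^sub>p = 1\<close> all entries have modulus at most \<open>1\<close>, where a larger exponent gives a
  smaller power.\<close>

lemma lp_norm_antimono:
  fixes x :: "real ^ 'q"
  assumes "0 < p" "p \<le> r"
  shows "lp_norm r x \<le> lp_norm p x"
proof (cases "x = 0")
  case True
  then show ?thesis using assms by (simp add: lp_norm_zero)
next
  case False
  define M where "M = lp_norm p x"
  have M: "M > 0" using False assms by (simp add: M_def lp_norm_pos)
  have le: "(\<bar>x $ l\<bar> / M) powr r \<le> (\<bar>x $ l\<bar> / M) powr p" for l
    using component_le_lp_norm[OF assms(1), of x l] M assms
    by (intro powr_mono') (auto simp: M_def)
  have "lp_norm r x powr r / M powr r = (\<Sum>l\<in>UNIV. (\<bar>x $ l\<bar> / M) powr r)"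
    using assms M by (simp add: lp_norm_powr powr_divide sum_divide_distrib)
  also have "\<dots> \<le> (\<Sum>l\<in>UNIV. (\<bar>x $ l\<bar> / M) powr p)"
    by (rule sum_mono) (rule le)
  also have "\<dots> = lp_norm p x powr p / M powr p"
    using assms M by (simp add: lp_norm_powr powr_divide sum_divide_distrib)
  also have "\<dots> = 1" using M by (simp add: M_def)
  finally have "lp_norm r x powr r \<le> M powr r" using M by (simp add: field_simps)
  then show ?thesis
    using powr_less_mono2[of r M "lp_norm r x"] assms M unfolding M_def by fastforce
qed

text \<open>This is the power mean inequality. Scaled so that the mean of the \<open>r\<close>-th powers is \<open>1\<close>, it
  follows by averaging over the entries the bound \<open>t\<^sup>p \<le> (p/r) t\<^sup>r + (1 - p/r)\<close>, which is the
  tangent at \<open>1\<close> of the concave function \<open>s\<^sup>p\<^sup>/\<^sup>r\<close>, taken at \<open>s = t\<^sup>r\<close>.\<close>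

lemma lp_norm_le_card_powr:
  fixes x :: "real ^ 'q"
  assumes "0 < p" "p \<le> r"
  shows "lp_norm p x \<le> real CARD('q) powr (1 / p - 1 / r) * lp_norm r x"
proof (cases "x = 0")
  case True
  then show ?thesis using assms by (simp add: lp_norm_zero)
next
  case False
  define q where "q = real CARD('q)"
  \<comment> \<open>The \<open>r\<close>-th power mean of the entries.\<close>
  define s where "s = lp_norm r x / q powr (1 / r)"
  have q: "q > 0" by (simp add: q_def)
  have s: "s > 0" using False assms q by (simp add: s_def lp_norm_pos)
  have sr: "s powr r = lp_norm r x powr r / q"
    using assms q lp_norm_nonneg[of r x] by (simp add: s_def powr_divide powr_powr)
  have tangent: "t powr p \<le> p / r * t powr r + (1 - p / r)" if "t \<ge> 0" for t :: real
  proof (cases "t = 0")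
    case True
    then show ?thesis using assms by simp
  next
    case False
    then have "(t powr r) powr (p / r) * 1 powr (1 - p / r) \<le> p / r * t powr r + (1 - p / r) * 1"
      using assms that by (intro Youngs_inequality_0) auto
    then show ?thesis using assms by (simp add: powr_powr)
  qed
  have "lp_norm p x powr p / s powr p = (\<Sum>l\<in>UNIV. (\<bar>x $ l\<bar> / s) powr p)"
    using assms s by (simp add: lp_norm_powr powr_divide sum_divide_distrib)
  also have "\<dots> \<le> (\<Sum>l\<in>UNIV. p / r * (\<bar>x $ l\<bar> / s) powr r + (1 - p / r))"
    using s by (intro sum_mono tangent) auto
  also have "\<dots> = p / r * (\<Sum>l\<in>UNIV. (\<bar>x $ l\<bar> / s) powr r) + q * (1 - p / r)"
    by (simp add: sum.distrib sum_distrib_left q_def)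
  also have "(\<Sum>l\<in>UNIV. (\<bar>x $ l\<bar> / s) powr r) = lp_norm r x powr r / s powr r"
    using assms s by (simp add: lp_norm_powr powr_divide sum_divide_distrib)
  also have "\<dots> = q"
    using q False assms lp_norm_pos[of r x] by (simp add: sr)
  also have "p / r * q + q * (1 - p / r) = q" by (simp add: algebra_simps)
  finally have "lp_norm p x powr p \<le> q * s powr p" using s by (simp add: field_simps)
  also have "\<dots> = (q powr (1 / p) * s) powr p"
    using assms q s by (simp add: powr_mult powr_powr)
  finally have "lp_norm p x \<le> q powr (1 / p) * s"
    using powr_less_mono2[of p "q powr (1 / p) * s" "lp_norm p x"] assms q s by fastforce
  also have "\<dots> = q powr (1 / p - 1 / r) * lp_norm r x" by (simp add: s_def powr_diff)
  finally show ?thesis by (simp add: q_def)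
qed

lemma N2_const_pos: "N2_const p TYPE('q::finite) > 0"
  by (simp add: N2_const_def)

lemma norm_le_N2_lp_norm:
  fixes x :: "real ^ 'q"
  assumes "p > 0"
  shows "norm x \<le> N2_const p TYPE('q) * lp_norm p x"
  using lp_norm_le_card_powr[of 2 p x] lp_norm_antimono[of p 2 x] assms
  by (auto simp: norm_eq_lp_norm_2 N2_const_def)

lemma c_const_le_norm:
  fixes w :: "real ^ 'q"
  assumes "lp_norm (p / (p - 1)) w = 1"
  shows "c_const p TYPE('q) \<le> norm w"
  unfolding c_const_def
  by (rule cInf_lower) (use assms in \<open>auto intro!: bdd_belowI[of _ 0]\<close>)

section \<open>The gradient of the norm and the projection\<close>

text \<open>The conjugate exponent \<open>p/(p - 1)\<close> turns the entries \<open>\<bar>z\<^sub>l\<bar>\<^sup>p\<^sup>-\<^sup>1\<close> back into \<open>\<bar>z\<^sub>l\<bar>\<^sup>p\<close>, whose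
  sum is the normalising factor.\<close>

lemma lp_norm_conjugate_grad:
  fixes z :: "real ^ 'q"
  assumes "p > 1" "z \<noteq> 0"
  shows "lp_norm (p / (p - 1)) (lp_grad p z) = 1"
proof -
  have N: "lp_norm p z > 0" using assms by (intro lp_norm_pos) auto
  have "\<bar>lp_grad p z $ l\<bar> powr (p / (p - 1)) = \<bar>z $ l\<bar> powr p / lp_norm p z powr p" for l
  proof -
    have "\<bar>lp_grad p z $ l\<bar> = \<bar>z $ l\<bar> powr (p - 1) / lp_norm p z powr (p - 1)"
      by (cases "z $ l = 0") (auto simp: lp_grad_def abs_mult)
    then show ?thesis using assms by (simp add: powr_divide powr_powr)
  qed
  then have "(\<Sum>l\<in>UNIV. \<bar>lp_grad p z $ l\<bar> powr (p / (p - 1))) =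
      (\<Sum>l\<in>UNIV. \<bar>z $ l\<bar> powr p) / lp_norm p z powr p"
    by (simp only: sum_divide_distrib)
  also have "\<dots> = lp_norm p z powr p / lp_norm p z powr p"
    using assms by (subst lp_norm_powr) auto
  also have "\<dots> = 1" using N by simp
  finally have "(\<Sum>l\<in>UNIV. \<bar>lp_grad p z $ l\<bar> powr (p / (p - 1))) = 1" .
  then show ?thesis by (simp add: lp_norm_def)
qed

lemma lp_proj_minimizes:
  fixes A :: "(real ^ 'q) set"
  assumes "p > 1" "compact A" "convex A" "A \<noteq> {}"
  shows "lp_proj p A v \<in> A"
    and "u \<in> A \<Longrightarrow> lp_norm p (lp_proj p A v - v) \<le> lp_norm p (u - v)"
proof -
  have "is_arg_min (\<lambda>y. lp_norm p (y - v)) (\<lambda>y. y \<in> A) (lp_proj p A v)"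
    unfolding lp_proj_def arg_min_def by (rule someI_ex) (use lp_proj_unique[OF assms] in blast)
  then show "lp_proj p A v \<in> A"
    and "u \<in> A \<Longrightarrow> lp_norm p (lp_proj p A v - v) \<le> lp_norm p (u - v)"
    by (auto simp: is_arg_min_linorder)
qed

text \<open>A negative inner product would make the norm decrease along the segment from the
  projection towards \<open>u\<close>, which stays in \<open>A\<close> by convexity.\<close>

lemma lp_proj_variational:
  fixes A :: "(real ^ 'q) set"
  assumes "p > 1" "compact A" "convex A" "v \<notin> A" "u \<in> A"
  defines "y \<equiv> lp_proj p A v"
  shows "lp_grad p (y - v) \<bullet> (u - y) \<ge> 0"
proof (rule ccontr)
  assume neg: "\<not> ?thesis"
  have "A \<noteq> {}" using assms by auto
  note y = lp_proj_minimizes[OF assms(1-3) this, where v = v, folded y_def]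
  have "y - v \<noteq> 0" using y(1) assms(4) by auto
  from lp_norm_gderiv[OF assms(1) this]
  have grad: "(lp_norm p has_derivative (\<lambda>h. h \<bullet> lp_grad p (y - v))) (at (y - v))"
    unfolding gderiv_def .
  let ?f = "\<lambda>t. lp_norm p (y - v + t *\<^sub>R (u - y))"
  have "((\<lambda>t. y - v + t *\<^sub>R (u - y)) has_derivative (\<lambda>t. t *\<^sub>R (u - y))) (at (0::real))"
    by (auto intro!: derivative_eq_intros)
  then have "(?f has_derivative (\<lambda>t. (t *\<^sub>R (u - y)) \<bullet> lp_grad p (y - v))) (at 0)"
    by (rule has_derivative_compose) (use grad in simp)
  then have "(?f has_real_derivative lp_grad p (y - v) \<bullet> (u - y)) (at 0)"
    by (rule has_derivative_imp_has_field_derivative) (simp add: inner_commute[of "u - y"])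
  from DERIV_neg_dec_right[OF this] neg
  obtain d where d: "d > 0" "\<And>t. 0 < t \<Longrightarrow> t < d \<Longrightarrow> ?f t < ?f 0"
    by (auto simp only: not_le add_0_left)
  define t where "t = min 1 (d / 2)"
  have t: "0 < t" "t < d" "t \<le> 1" using d by (auto simp: t_def)
  have "y + t *\<^sub>R (u - y) \<in> A"
    using convexD_alt[OF assms(3) y(1) assms(5), of t] t by (simp add: algebra_simps)
  from y(2)[OF this] have "?f 0 \<le> ?f t" by (simp add: algebra_simps)
  then show False using d(2)[OF t(1,2)] by simp
qed

text \<open>From an interior point, a short step in the direction \<open>-w\<close> stays in \<open>A\<close> and lowers the
  functional, so a minimizer cannot be interior.\<close>

lemma linear_minimizer_in_frontier:
  fixes w y :: "'a::euclidean_space"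
  assumes "w \<noteq> 0" "y \<in> A" "\<And>u. u \<in> A \<Longrightarrow> w \<bullet> (u - y) \<ge> 0"
  shows "y \<in> frontier A"
proof -
  have "y \<notin> interior A"
  proof
    assume "y \<in> interior A"
    then obtain e where e: "e > 0" "cball y e \<subseteq> A" by (auto simp: mem_interior_cball)
    have "y - (e / norm w) *\<^sub>R w \<in> cball y e" using e assms(1) by (simp add: dist_norm)
    then have "w \<bullet> (- ((e / norm w) *\<^sub>R w)) \<ge> 0" using e assms(3) by fastforce
    moreover have "(e / norm w) * (w \<bullet> w) > 0" using e assms(1) by simp
    ultimately show False by simp
  qed
  then show ?thesis using assms(2) closure_subset by (auto simp: frontier_def)
qed

section \<open>The separation estimates\<close>

lemma norm_shifted_diff_square:
  fixes y y' w w' :: "'a::real_inner"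
  shows "(norm ((y - \<eta> *\<^sub>R w) - (y' - \<eta> *\<^sub>R w')))\<^sup>2 =
    (norm (y - y'))\<^sup>2 + 2 * \<eta> * (w' \<bullet> (y - y') + w \<bullet> (y' - y)) + \<eta>\<^sup>2 * (norm (w - w'))\<^sup>2"
proof -
  define a b where "a = y - y'" and "b = w - w'"
  have "(y - \<eta> *\<^sub>R w) - (y' - \<eta> *\<^sub>R w') = a - \<eta> *\<^sub>R b"
    unfolding a_def b_def scaleR_diff_right by simp
  moreover have "(norm (a - \<eta> *\<^sub>R b))\<^sup>2 = (norm a)\<^sup>2 - 2 * \<eta> * (b \<bullet> a) + \<eta>\<^sup>2 * (norm b)\<^sup>2"
    unfolding power2_norm_eq_inner
    by (simp add: inner_diff_left inner_diff_right inner_commute[of a b] power2_eq_square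
        right_diff_distrib)
  moreover have "w' \<bullet> a + w \<bullet> (y' - y) = - (b \<bullet> a)"
    by (simp add: a_def b_def inner_diff_left inner_diff_right)
  ultimately show ?thesis by (simp flip: a_def b_def)
qed

theorem lemma8:
  fixes p \<eta> d\<^sub>i\<^sub>j d\<^sub>j\<^sub>i :: real
    and A P :: "(real ^ 'q) set" and k :: nat
    and v\<^sub>i v\<^sub>j y\<^sub>i y\<^sub>j z\<^sub>i z\<^sub>j w\<^sub>i w\<^sub>j \<alpha>\<^sub>i \<alpha>\<^sub>j :: "real ^ 'q"
  assumes "1 < p" and "0 < \<eta>"
    and "compact A" and "convex A" and "interior A \<noteq> {}"
    and "norm_min_approx p A k P"
    and "v\<^sub>i extreme_point_of P" and "v\<^sub>i \<notin> A"
    and "v\<^sub>j extreme_point_of P" and "v\<^sub>j \<notin> A"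
    and "y\<^sub>i = lp_proj p A v\<^sub>i" and "y\<^sub>j = lp_proj p A v\<^sub>j"
    and "z\<^sub>i = y\<^sub>i - v\<^sub>i" and "z\<^sub>j = y\<^sub>j - v\<^sub>j"
    and "w\<^sub>i = lp_grad p z\<^sub>i" and "w\<^sub>j = lp_grad p z\<^sub>j"
    and "\<alpha>\<^sub>i = y\<^sub>i - \<eta> *\<^sub>R w\<^sub>i" and "\<alpha>\<^sub>j = y\<^sub>j - \<eta> *\<^sub>R w\<^sub>j"
    and "d\<^sub>i\<^sub>j = w\<^sub>j \<bullet> (y\<^sub>i - y\<^sub>j)" and "d\<^sub>j\<^sub>i = w\<^sub>i \<bullet> (y\<^sub>j - y\<^sub>i)"
  shows "y\<^sub>i \<in> frontier A \<and> y\<^sub>j \<in> frontier A \<and>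
    lp_norm (p / (p - 1)) w\<^sub>i = 1 \<and> lp_norm (p / (p - 1)) w\<^sub>j = 1 \<and>
    d\<^sub>i\<^sub>j \<ge> 0 \<and> d\<^sub>j\<^sub>i \<ge> 0 \<and>
    c_const p TYPE('q) > 0 \<and>
    (\<forall>h>0. d\<^sub>i\<^sub>j \<ge> h \<longrightarrow>
           lp_norm p (\<alpha>\<^sub>i - \<alpha>\<^sub>j) \<ge> C3_const p TYPE('q) * sqrt (\<eta> * h)) \<and>
    (w\<^sub>i \<bullet> w\<^sub>j \<le> 0 \<longrightarrow> lp_norm p (\<alpha>\<^sub>i - \<alpha>\<^sub>j) \<ge> C2_const p TYPE('q) * \<eta>) \<and>
    (\<forall>h>0. d\<^sub>i\<^sub>j \<ge> h \<or> w\<^sub>i \<bullet> w\<^sub>j \<le> 0 \<longrightarrow>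
           lp_norm p (\<alpha>\<^sub>i - \<alpha>\<^sub>j) \<ge>
             min (C2_const p TYPE('q) * \<eta>) (C3_const p TYPE('q) * sqrt (\<eta> * h)))"
proof -
  let ?N = "N2_const p TYPE('q)" and ?c = "c_const p TYPE('q)"
  have ne: "A \<noteq> {}" using assms(5) by auto
  have yA: "y\<^sub>i \<in> A" "y\<^sub>j \<in> A"
    using lp_proj_minimizes(1)[OF assms(1,3,4) ne] assms by auto
  have z: "z\<^sub>i \<noteq> 0" "z\<^sub>j \<noteq> 0" using yA assms by auto
  have dual: "lp_norm (p / (p - 1)) w\<^sub>i = 1" "lp_norm (p / (p - 1)) w\<^sub>j = 1"
    using lp_norm_conjugate_grad[OF assms(1) z(1)] lp_norm_conjugate_grad[OF assms(1) z(2)] assms(15,16) by (simp_all only:)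
  have cpos: "?c > 0" by (rule c_const_attained(1)[OF assms(1)])
  have cw: "?c \<le> norm w\<^sub>i" "?c \<le> norm w\<^sub>j" using dual by (auto intro: c_const_le_norm)
  have var: "w\<^sub>i \<bullet> (u - y\<^sub>i) \<ge> 0" "w\<^sub>j \<bullet> (u - y\<^sub>j) \<ge> 0" if "u \<in> A" for u
    using lp_proj_variational[OF assms(1,3,4) _ that] assms by auto
  have w0: "w\<^sub>i \<noteq> 0" "w\<^sub>j \<noteq> 0" using cw cpos by auto
  have front: "y\<^sub>i \<in> frontier A" "y\<^sub>j \<in> frontier A"
    using w0 yA var linear_minimizer_in_frontier[of w\<^sub>i y\<^sub>i A]
      linear_minimizer_in_frontier[of w\<^sub>j y\<^sub>j A] by auto
  have d: "d\<^sub>i\<^sub>j \<ge> 0" "d\<^sub>j\<^sub>i \<ge> 0" using var(1)[OF yA(2)] var(2)[OF yA(1)] assms(19,20) by simp_all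
  have square: "(norm (\<alpha>\<^sub>i - \<alpha>\<^sub>j))\<^sup>2 =
      (norm (y\<^sub>i - y\<^sub>j))\<^sup>2 + 2 * \<eta> * (d\<^sub>i\<^sub>j + d\<^sub>j\<^sub>i) + \<eta>\<^sup>2 * (norm (w\<^sub>i - w\<^sub>j))\<^sup>2"
    unfolding assms(17-20) by (rule norm_shifted_diff_square)
  have from_square: "b / ?N \<le> lp_norm p (\<alpha>\<^sub>i - \<alpha>\<^sub>j)" if "b\<^sup>2 \<le> (norm (\<alpha>\<^sub>i - \<alpha>\<^sub>j))\<^sup>2" for b
  proof -
    have "b \<le> norm (\<alpha>\<^sub>i - \<alpha>\<^sub>j)" using that by (rule power2_le_imp_le) simp
    also have "\<dots> \<le> ?N * lp_norm p (\<alpha>\<^sub>i - \<alpha>\<^sub>j)"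
      using assms(1) by (intro norm_le_N2_lp_norm) auto
    finally show ?thesis
      using N2_const_pos[of p, where 'q='q] by (simp add: divide_le_eq mult.commute)
  qed
  have i: "C3_const p TYPE('q) * sqrt (\<eta> * h) \<le> lp_norm p (\<alpha>\<^sub>i - \<alpha>\<^sub>j)"
    if "h > 0" "d\<^sub>i\<^sub>j \<ge> h" for h
  proof -
    have "2 * (\<eta> * h) \<le> 2 * \<eta> * (d\<^sub>i\<^sub>j + d\<^sub>j\<^sub>i)" using that d assms(2) by simp
    then have "(sqrt 2 * sqrt (\<eta> * h))\<^sup>2 \<le> (norm (\<alpha>\<^sub>i - \<alpha>\<^sub>j))\<^sup>2"
      using that assms(2) by (simp add: square power_mult_distrib add_increasing add_increasing2)
    from from_square[OF this] show ?thesis by (simp add: C3_const_def)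
  qed
  have ii: "C2_const p TYPE('q) * \<eta> \<le> lp_norm p (\<alpha>\<^sub>i - \<alpha>\<^sub>j)" if "w\<^sub>i \<bullet> w\<^sub>j \<le> 0"
  proof -
    have "2 * ?c\<^sup>2 \<le> (norm w\<^sub>i)\<^sup>2 + (norm w\<^sub>j)\<^sup>2"
      using power_mono[OF cw(1), of 2] power_mono[OF cw(2), of 2] cpos by linarith
    also have "\<dots> \<le> (norm (w\<^sub>i - w\<^sub>j))\<^sup>2"
      using that by (simp add: power2_norm_eq_inner inner_diff_left inner_diff_right inner_commute)
    finally have "\<eta>\<^sup>2 * (2 * ?c\<^sup>2) \<le> \<eta>\<^sup>2 * (norm (w\<^sub>i - w\<^sub>j))\<^sup>2" by (simp add: mult_left_mono)
    moreover have "0 \<le> 2 * \<eta> * (d\<^sub>i\<^sub>j + d\<^sub>j\<^sub>i)" using d assms(2) by simp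
    ultimately have "\<eta>\<^sup>2 * (2 * ?c\<^sup>2) \<le> (norm (\<alpha>\<^sub>i - \<alpha>\<^sub>j))\<^sup>2"
      unfolding square by (simp add: add_increasing)
    then have "(sqrt 2 * ?c * \<eta>)\<^sup>2 \<le> (norm (\<alpha>\<^sub>i - \<alpha>\<^sub>j))\<^sup>2"
      by (simp add: power_mult_distrib mult_ac)
    from from_square[OF this] show ?thesis by (simp add: C2_const_def)
  qed
  show ?thesis using front dual d cpos i ii by (auto simp: min_le_iff_disj)
qed

end
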